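(* Let $n,k\ge 1$ and let $H=[H_{ij}]_{i,j=1}^n\in \mathbb{M}_n(\mathbb{M}_k)$ be positive semidefinite. Then for every positive integer $r$, $$\left(\frac{\det\bigl[(\mathrm{tr}\,H_{ij})^r\bigr]_{i,j=1}^n}{k^{rn}}\right)^k\ \ge\ (\det H)^r .$$
   Context: $\mathbb{M}_k$ denotes the set of $k\times k$ complex matrices. $\mathbb{M}_n(\mathbb{M}_k)$ denotes the set of complex $nk\times nk$ matrices partitioned into $n\times n$ blocks, each block $H_{ij}$ being a $k\times k$ matrix. "Positive semidefinite" refers to $H$ as an $nk\times nk$ complex (Hermitian) matrix. $[(\mathrm{tr}\,H_{ij})^r]_{i,j=1}^n$ is the $n\times n$ complex matrix whose $(i,j)$ entry is the $r$-th power of the trace of the block $H_{ij}$. *)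

theory Defs
  imports "Jordan_Normal_Form.Schur_Decomposition"
begin

definition mat_tr :: "'a :: comm_monoid_add mat \<Rightarrow> 'a"
  where "mat_tr A = (\<Sum>i<dim_row A. A $$ (i, i))"

(* With indices starting at 0, block (i, j) of a matrix partitioned into k x k blocks
   occupies the rows i*k, ..., i*k + k - 1 and the columns j*k, ..., j*k + k - 1. *)
definition mat_block :: "nat \<Rightarrow> 'a mat \<Rightarrow> nat \<Rightarrow> nat \<Rightarrow> 'a mat"
  where "mat_block k H i j = mat k k (\<lambda>(a, b). H $$ (i * k + a, j * k + b))"

(* (A *\<^sub>v v) \<bullet>c v is v* A v, which is real because A is Hermitian. *)
definition positive_semidefinite :: "complex mat \<Rightarrow> bool"
  where "positive_semidefinite A \<longleftrightarrow>
    square_mat A \<and> mat_adjoint A = A \<and>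
    (\<forall>v \<in> carrier_vec (dim_row A). 0 \<le> Re ((A *\<^sub>v v) \<bullet>c v))"

definition trace_power_mat :: "nat \<Rightarrow> nat \<Rightarrow> nat \<Rightarrow> complex mat \<Rightarrow> complex mat"
  where "trace_power_mat n k r H = mat n n (\<lambda>(i, j). (mat_tr (mat_block k H i j)) ^ r)"

end

theory Submission
  imports Defs
begin

text \<open>
  Let \<open>T\<close> be the matrix of block traces, with Cholesky factorisation \<open>T = C C*\<close>
  (\<open>C\<close> lower triangular), and let \<open>x = |det C|^2\<close>.

  Upper bound for \<open>det H\<close>: if \<open>C\<close> has an inverse \<open>S\<close>, then
  \<open>G = (S \<otimes> I) H (S \<otimes> I)*\<close> is positive semidefinite with trace \<open>tr (S T S*) = n\<close>, so AM-GM
  for its eigenvalues gives \<open>det G \<le> (1/k)^(nk)\<close>, that is, \<open>det H \<le> (x / k^n)^k\<close>. If \<open>C\<close> is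
  singular, an isotropic vector of \<open>T\<close> lifts to one of \<open>H\<close>, and \<open>det H = 0\<close>.

  Lower bound for the Hadamard power: expanding the \<open>r\<close>-th power of \<open>T = C C*\<close> and discarding the
  mixed terms shows that it dominates \<open>W W*\<close>, where \<open>W\<close> is the entrywise \<open>r\<close>-th power of \<open>C\<close>.
  As \<open>W\<close> is lower triangular, \<open>det W = (det C)^r\<close>, so the Hadamard power has determinant at
  least \<open>x^r\<close>.
\<close>

subsection \<open>Hermitian forms\<close>

text \<open>Matrices and vectors are functions on all of nat with the size as a separate argument,
  so index shifts (\<open>case_nat\<close>) and block indices (\<open>div\<close>,
  \<open>mod\<close>) need no carrier conditions; \<open>fmat\<close> passes to actual matrices for
  determinants, products and inverses.\<close>

definition qform :: "nat \<Rightarrow> (nat \<Rightarrow> nat \<Rightarrow> complex) \<Rightarrow> (nat \<Rightarrow> complex) \<Rightarrow> complex"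
  where "qform n M v = (\<Sum>i<n. \<Sum>j<n. cnj (v i) * M i j * v j)"

definition hermitian :: "nat \<Rightarrow> (nat \<Rightarrow> nat \<Rightarrow> complex) \<Rightarrow> bool"
  where "hermitian n M \<longleftrightarrow> (\<forall>i<n. \<forall>j<n. M j i = cnj (M i j))"

definition psd :: "nat \<Rightarrow> (nat \<Rightarrow> nat \<Rightarrow> complex) \<Rightarrow> bool"
  where "psd n M \<longleftrightarrow> hermitian n M \<and> (\<forall>v. 0 \<le> Re (qform n M v))"

definition fmat :: "nat \<Rightarrow> (nat \<Rightarrow> nat \<Rightarrow> complex) \<Rightarrow> complex mat"
  where "fmat n M = mat n n (\<lambda>(i, j). M i j)"

lemma fmat_carrier [simp]: "fmat n M \<in> carrier_mat n n"
  by (simp add: fmat_def)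

lemma fmat_index [simp]: "i < n \<Longrightarrow> j < n \<Longrightarrow> fmat n M $$ (i, j) = M i j"
  by (simp add: fmat_def)

lemma fmat_dim [simp]: "dim_row (fmat n M) = n" "dim_col (fmat n M) = n"
  by (simp_all add: fmat_def)

lemma fmat_mult: "fmat n A * fmat n B = fmat n (\<lambda>i j. \<Sum>m<n. A i m * B m j)"
  by (rule eq_matI) (auto simp: scalar_prod_def atLeast0LessThan)

lemma fmat_cong: "(\<And>i j. i < n \<Longrightarrow> j < n \<Longrightarrow> A i j = B i j) \<Longrightarrow> fmat n A = fmat n B"
  by (rule eq_matI) auto

lemma fmat_of_mat: "A \<in> carrier_mat n n \<Longrightarrow> fmat n (\<lambda>i j. A $$ (i, j)) = A"
  by (rule eq_matI) auto

lemma qform_cong: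
  "(\<And>i j. i < n \<Longrightarrow> j < n \<Longrightarrow> A i j = B i j) \<Longrightarrow> (\<And>i. i < n \<Longrightarrow> v i = w i)
    \<Longrightarrow> qform n A v = qform n B w"
  unfolding qform_def by (intro sum.cong refl) simp_all

lemma hermitianD: "hermitian n M \<Longrightarrow> i < n \<Longrightarrow> j < n \<Longrightarrow> M j i = cnj (M i j)"
  unfolding hermitian_def by blast

lemma hermitianI:
  "(\<And>i j. i < n \<Longrightarrow> j < n \<Longrightarrow> M j i = cnj (M i j)) \<Longrightarrow> hermitian n M"
  unfolding hermitian_def by blast

lemma psd_hermitian: "psd n M \<Longrightarrow> hermitian n M"
  by (simp add: psd_def)

lemma psd_qform: "psd n M \<Longrightarrow> 0 \<le> Re (qform n M v)"
  by (simp add: psd_def)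

lemma psdI: "hermitian n M \<Longrightarrow> (\<And>v. 0 \<le> Re (qform n M v)) \<Longrightarrow> psd n M"
  by (simp add: psd_def)

lemma psd_cong:
  assumes "psd n A" and eq: "\<And>i j. i < n \<Longrightarrow> j < n \<Longrightarrow> A i j = B i j"
  shows "psd n B"
  unfolding psd_def
proof (intro conjI allI hermitianI)
  fix i j assume "i < n" "j < n"
  then show "B j i = cnj (B i j)"
    using hermitianD[of n A i j] assms(1) by (simp add: psd_def eq)
next
  fix v
  have "qform n A v = qform n B v"
    by (intro qform_cong eq refl)
  then show "0 \<le> Re (qform n B v)"
    using assms(1) unfolding psd_def by metis
qed

lemma qform_add: "qform n (\<lambda>i j. A i j + B i j) v = qform n A v + qform n B v"
  by (simp add: qform_def algebra_simps sum.distrib)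

lemma hermitian_add:
  assumes "hermitian n A" "hermitian n B"
  shows "hermitian n (\<lambda>i j. A i j + B i j)"
proof (rule hermitianI)
  fix i j assume "i < n" "j < n"
  then have "A j i = cnj (A i j)" "B j i = cnj (B i j)"
    using assms by (auto dest: hermitianD)
  then show "A j i + B j i = cnj (A i j + B i j)"
    by simp
qed

lemma psd_add: "psd n A \<Longrightarrow> psd n B \<Longrightarrow> psd n (\<lambda>i j. A i j + B i j)"
  by (simp add: psd_def hermitian_add qform_add)

lemma qform_diff: "qform n (\<lambda>i j. A i j - B i j) v = qform n A v - qform n B v"
  by (simp add: qform_def algebra_simps sum_subtractf)

lemma positive_semidefinite_imp_psd:
  assumes H: "H \<in> carrier_mat n n" and psd: "positive_semidefinite H"
  shows "psd n (\<lambda>i j. H $$ (i, j))"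
  unfolding psd_def
proof (intro conjI allI hermitianI)
  fix i j assume ij: "i < n" "j < n"
  have "H $$ (j, i) = mat_adjoint H $$ (j, i)"
    using psd by (simp add: positive_semidefinite_def)
  also have "\<dots> = cnj (H $$ (i, j))"
    using H ij by (simp add: mat_adjoint_def mat_of_rows_def)
  finally show "H $$ (j, i) = cnj (H $$ (i, j))" .
next
  fix v
  have "(H *\<^sub>v vec n v) \<bullet>c vec n v = qform n (\<lambda>i j. H $$ (i, j)) v"
    using H
    by (simp add: scalar_prod_def qform_def atLeast0LessThan sum_distrib_left sum_distrib_right
        mult_ac)
  moreover have "0 \<le> Re ((H *\<^sub>v vec n v) \<bullet>c vec n v)"
    using psd H by (simp add: positive_semidefinite_def)
  ultimately show "0 \<le> Re (qform n (\<lambda>i j. H $$ (i, j)) v)"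
    by simp
qed

lemma qform_hermitian_real:
  assumes "hermitian n M" shows "qform n M v \<in> \<real>"
proof -
  have "cnj (qform n M v) = (\<Sum>i<n. \<Sum>j<n. cnj (v j) * M j i * v i)"
    unfolding qform_def cnj_sum
  proof (intro sum.cong refl)
    fix i j assume "i \<in> {..<n}" "j \<in> {..<n}"
    then have "M j i = cnj (M i j)"
      using assms by (intro hermitianD) auto
    then show "cnj (cnj (v i) * M i j * v j) = cnj (v j) * M j i * v i"
      by simp
  qed
  also have "\<dots> = qform n M v"
    unfolding qform_def by (rule sum.swap)
  finally show ?thesis
    by (simp add: Reals_cnj_iff)
qed

subsection \<open>Eigenvalue bounds for determinants\<close>

lemma trace_mult_commute:
  fixes A B :: "'a :: comm_semiring_0 mat"
  assumes "A \<in> carrier_mat n m" "B \<in> carrier_mat m n"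
  shows "mat_tr (A * B) = mat_tr (B * A)"
proof -
  have "mat_tr (A * B) = (\<Sum>i<n. \<Sum>j<m. A $$ (i, j) * B $$ (j, i))"
    using assms by (simp add: mat_tr_def scalar_prod_def atLeast0LessThan)
  also have "\<dots> = (\<Sum>j<m. \<Sum>i<n. B $$ (j, i) * A $$ (i, j))"
    by (subst sum.swap) (simp add: mult.commute)
  also have "\<dots> = mat_tr (B * A)"
    using assms by (simp add: mat_tr_def scalar_prod_def atLeast0LessThan)
  finally show ?thesis .
qed

text \<open>The Schur decomposition puts the eigenvalues on the diagonal, so determinant and trace
  are their product and sum. At an eigenvector the form is the eigenvalue times the squared norm; as
  the form is real and bounded below, so is the eigenvalue. The bound \<open>c\<close> is later 0 or
  1.\<close>

lemma hermitian_spectrum: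
  assumes herm: "hermitian n M"
    and low: "\<And>v. c * (\<Sum>i<n. (cmod (v i))\<^sup>2) \<le> Re (qform n M v)"
  obtains es :: "real list" where "length es = n" "\<And>e. e \<in> set es \<Longrightarrow> c \<le> e"
    "det (fmat n M) = of_real (prod_list es)" "(\<Sum>i<n. M i i) = of_real (sum_list es)"
proof -
  let ?A = "fmat n M"
  obtain as where as: "char_poly ?A = (\<Prod>a\<leftarrow>as. [:- a, 1:])" "length as = n"
    using char_poly_factorized[OF fmat_carrier] by blast
  obtain B P Q where dec: "schur_decomposition ?A as = (B, P, Q)"
    by (cases "schur_decomposition ?A as") auto
  note sd = schur_decomposition[OF fmat_carrier as(1) dec]
  note sim = similar_mat_witD2[OF fmat_carrier conjunct1[OF sd]]
  have ev: "\<exists>e. a = of_real e \<and> c \<le> e" if a: "a \<in> set as" for a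
  proof -
    have "poly (char_poly ?A) a = 0"
      using a by (simp add: as(1) poly_prod_list prod_list_zero_iff)
    then have "eigenvalue ?A a"
      by (simp add: eigenvalue_root_char_poly[OF fmat_carrier])
    then obtain v where v: "v \<in> carrier_vec n" "v \<noteq> 0\<^sub>v n" "?A *\<^sub>v v = a \<cdot>\<^sub>v v"
      by (auto simp: eigenvalue_def eigenvector_def)
    define s where "s = (\<Sum>i<n. (cmod (v $ i))\<^sup>2)"
    have row: "(\<Sum>j<n. M i j * v $ j) = a * v $ i" if "i < n" for i
      using arg_cong[OF v(3), of "\<lambda>w. w $ i"] that v(1)
      by (simp add: scalar_prod_def atLeast0LessThan)
    have "qform n M (\<lambda>i. v $ i) = (\<Sum>i<n. cnj (v $ i) * (\<Sum>j<n. M i j * v $ j))"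
      by (simp add: qform_def sum_distrib_left mult.assoc)
    also have "\<dots> = (\<Sum>i<n. a * of_real ((cmod (v $ i))\<^sup>2))"
      by (rule sum.cong) (simp_all add: row complex_norm_square mult_ac del: of_real_power)
    also have "\<dots> = a * of_real s"
      by (simp add: s_def sum_distrib_left)
    finally have q: "qform n M (\<lambda>i. v $ i) = a * of_real s" .
    obtain i where "i < n" "v $ i \<noteq> 0"
      using v(1,2) by (metis eq_vecI carrier_vecD index_zero_vec)
    then have s: "s > 0"
      unfolding s_def by (intro sum_pos2[of _ i]) auto
    have "Im (a * of_real s) = 0"
      using qform_hermitian_real[OF herm, of "\<lambda>i. v $ i"] q by (simp add: complex_is_Real_iff)
    then have "Im a = 0"
      using s by simp
    moreover have "c * s \<le> Re a * s"
      using low[of "\<lambda>i. v $ i"] q by (simp add: s_def)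
    then have "c \<le> Re a"
      using s by simp
    ultimately show ?thesis
      by (intro exI[of _ "Re a"]) (simp add: complex_eq_iff)
  qed
  have Re_as: "map (\<lambda>x. of_real (Re x)) as = as"
  proof (rule map_idI)
    fix a assume "a \<in> set as"
    from ev[OF this] show "complex_of_real (Re a) = a"
      by auto
  qed
  have "det ?A = det B"
    by (rule det_similar) (use sd in \<open>auto simp: similar_mat_def\<close>)
  also have "\<dots> = prod_list as"
    using det_upper_triangular[OF _ sim(5)] sd by simp
  finally have det: "det ?A = prod_list as" .
  have "(\<Sum>i<n. M i i) = mat_tr ?A"
    by (simp add: mat_tr_def)
  also have "\<dots> = mat_tr (P * (B * Q))"
    using sim by (simp add: assoc_mult_mat[of _ n n _ n _ n])
  also have "\<dots> = mat_tr ((B * Q) * P)"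
    using sim by (intro trace_mult_commute) auto
  also have "(B * Q) * P = B"
    using sim by (simp add: assoc_mult_mat[of _ n n _ n _ n])
  also have "mat_tr B = sum_list (diag_mat B)"
    by (simp add: mat_tr_def diag_mat_def sum_list_sum_nth atLeast0LessThan)
  finally have tr: "(\<Sum>i<n. M i i) = sum_list as"
    using sd by simp
  have "prod_list as = of_real (prod_list (map Re as))"
    by (subst Re_as[symmetric]) (induction as; simp)
  moreover have "sum_list as = of_real (sum_list (map Re as))"
    by (subst Re_as[symmetric]) (induction as; simp)
  ultimately show ?thesis
    using that[of "map Re as"] as(2) ev det tr by fastforce
qed

text \<open>The form dominates that of the identity, so every eigenvalue is at least 1.\<close>

lemma hermitian_det_ge_one:
  assumes "hermitian n M" "\<And>v. (\<Sum>i<n. (cmod (v i))\<^sup>2) \<le> Re (qform n M v)"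
  shows "1 \<le> Re (det (fmat n M))"
proof -
  obtain es where es: "\<And>e. e \<in> set es \<Longrightarrow> 1 \<le> e" "det (fmat n M) = of_real (prod_list es)"
    using hermitian_spectrum[OF assms(1), of 1] assms(2) by auto
  have "1 \<le> prod_list es"
    using es(1)
  proof (induction es)
    case (Cons e es)
    then have "1 \<le> e" "1 \<le> prod_list es"
      by simp_all
    then have "1 * 1 \<le> e * prod_list es"
      by (intro mult_mono) simp_all
    then show ?case by simp
  qed simp
  then show ?thesis
    by (simp add: es(2))
qed

lemma psd_spectrum:
  assumes "psd n M"
  obtains es :: "real list" where "length es = n" "\<And>e. e \<in> set es \<Longrightarrow> 0 \<le> e"
    "det (fmat n M) = of_real (prod_list es)" "(\<Sum>i<n. M i i) = of_real (sum_list es)"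
  using hermitian_spectrum[of n M 0] assms by (auto simp: psd_def)

lemma psd_det:
  assumes "psd n M"
  shows "det (fmat n M) \<in> \<real>" "0 \<le> Re (det (fmat n M))"
proof -
  obtain es where es: "\<And>e. e \<in> set es \<Longrightarrow> 0 \<le> e" "det (fmat n M) = of_real (prod_list es)"
    using psd_spectrum[OF assms] by metis
  show "det (fmat n M) \<in> \<real>"
    by (simp add: es(2))
  have "0 \<le> prod_list es"
    using es(1) by (induction es) auto
  then show "0 \<le> Re (det (fmat n M))"
    by (simp add: es(2))
qed

text \<open>AM-GM for eigenvalues of mean at most \<open>c\<close>, without roots: multiplying e / c
  \<le> exp (e / c - 1) over all eigenvalues e leaves the exponent trace / c - n, which is at most
  0.\<close>

lemma psd_det_le_trace:
  assumes "psd n M" and c: "c > 0" and tr: "Re (\<Sum>i<n. M i i) \<le> real n * c"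
  shows "Re (det (fmat n M)) \<le> c ^ n"
proof -
  obtain es where es: "length es = n" "\<And>e. e \<in> set es \<Longrightarrow> 0 \<le> e"
    "det (fmat n M) = of_real (prod_list es)" "(\<Sum>i<n. M i i) = of_real (sum_list es)"
    using psd_spectrum[OF assms(1)] by metis
  have "prod_list es \<le> c ^ length es * exp (sum_list es / c - real (length es))"
    using es(2)
  proof (induction es)
    case (Cons e es)
    have "e / c \<le> exp (e / c - 1)"
      using exp_ge_add_one_self[of "e / c - 1"] by simp
    then have "e \<le> c * exp (e / c - 1)"
      using c by (simp add: field_simps)
    then have "e * prod_list es
        \<le> (c * exp (e / c - 1)) * (c ^ length es * exp (sum_list es / c - real (length es)))"
      using Cons c by (intro mult_mono) (auto intro!: prod_list_nonneg)
    also have "\<dots> = c ^ Suc (length es) * (exp (e / c - 1) * exp (sum_list es / c - real (length es)))"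
      by simp
    also have "exp (e / c - 1) * exp (sum_list es / c - real (length es))
        = exp (sum_list (e # es) / c - real (length (e # es)))"
      by (simp add: exp_add[symmetric] add_divide_distrib)
    finally show ?case by simp
  qed simp
  also have "\<dots> \<le> c ^ n * 1"
  proof -
    have "sum_list es / c \<le> real n"
      using tr c by (simp add: es(4) pos_divide_le_eq)
    then show ?thesis
      using c by (simp add: es(1))
  qed
  finally show ?thesis
    by (simp add: es(3))
qed

subsection \<open>Gram matrices and the Cholesky factorisation\<close>

text \<open>Isotropic vectors lie in the kernel: otherwise moving \<open>v\<close> slightly against
  w = M v makes the form negative, because the gain is linear in the step and the cost
  quadratic.\<close>

lemma psd_isotropic:
  assumes psd: "psd n M" and zero: "Re (qform n M v) = 0" and i: "i < n"
  shows "(\<Sum>j<n. M i j * v j) = 0"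
proof (rule ccontr)
  assume nz: "(\<Sum>j<n. M i j * v j) \<noteq> 0"
  define w where "w = (\<lambda>i. \<Sum>j<n. M i j * v j)"
  define s where "s = (\<Sum>i<n. (cmod (w i))\<^sup>2)"
  define Q where "Q = Re (qform n M w)"
  have s: "s > 0"
    unfolding s_def using i nz by (intro sum_pos2[of _ i]) (auto simp: w_def)
  have Q: "Q \<ge> 0"
    unfolding Q_def by (rule psd_qform[OF psd])
  have norm_w: "(\<Sum>i<n. cnj (w i) * w i) = of_real s"
    by (simp add: s_def mult.commute complex_norm_square del: of_real_power)
  have left: "(\<Sum>i<n. \<Sum>j<n. cnj (w i) * M i j * v j) = of_real s"
    by (simp add: norm_w[symmetric] sum_distrib_left mult.assoc)
      (simp add: w_def sum_distrib_left mult.assoc)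
  have "(\<Sum>i<n. \<Sum>j<n. cnj (v i) * M i j * w j) = (\<Sum>j<n. \<Sum>i<n. cnj (v i) * M i j * w j)"
    by (rule sum.swap)
  also have "\<dots> = (\<Sum>j<n. \<Sum>i<n. cnj (M j i * v i) * w j)"
  proof (intro sum.cong refl)
    fix i j assume "i \<in> {..<n}" "j \<in> {..<n}"
    then have "M i j = cnj (M j i)"
      using hermitianD[OF psd_hermitian[OF psd], of j i] by simp
    then show "cnj (v i) * M i j * w j = cnj (M j i * v i) * w j"
      by simp
  qed
  also have "\<dots> = of_real s"
    by (simp add: norm_w[symmetric] sum_distrib_right[symmetric])
      (simp add: w_def)
  finally have right: "(\<Sum>i<n. \<Sum>j<n. cnj (v i) * M i j * w j) = of_real s" .
  \<comment> \<open>Any t > 0 with t * Q < 2 * s would do; the summand 1 keeps the denominator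
    positive when \<open>Q = 0\<close>.\<close>
  define t where "t = s / (Q + 1)"
  have "qform n M (\<lambda>i. v i - of_real t * w i)
      = (\<Sum>i<n. \<Sum>j<n. cnj (v i) * M i j * v j - of_real t * (cnj (v i) * M i j * w j)
          - of_real t * (cnj (w i) * M i j * v j) + of_real (t * t) * (cnj (w i) * M i j * w j))"
    unfolding qform_def by (intro sum.cong refl) (simp add: algebra_simps)
  also have "\<dots> = qform n M v - of_real t * of_real s - of_real t * of_real s
      + of_real (t * t) * qform n M w"
    by (simp only: sum.distrib sum_subtractf sum_distrib_left[symmetric] left right qform_def)
  finally have expand: "qform n M (\<lambda>i. v i - of_real t * w i)
      = qform n M v - of_real t * of_real s - of_real t * of_real s + of_real (t * t) * qform n M w" .
  have "Re (qform n M (\<lambda>i. v i - of_real t * w i)) = t * (t * Q - 2 * s)"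
    unfolding expand by (simp add: zero Q_def algebra_simps)
  moreover have "t * Q \<le> s"
    unfolding t_def using Q s by (simp add: field_simps)
  then have "t * (t * Q - 2 * s) < 0"
    using Q s by (intro mult_pos_neg) (auto simp: t_def)
  ultimately show False
    using psd_qform[OF psd, of "\<lambda>i. v i - of_real t * w i"] by simp
qed

text \<open>The form of F F* at v is the squared norm of F* v. The index set is left general because
  it will also consist of pairs.\<close>

lemma qform_gram:
  "qform n (\<lambda>i j. \<Sum>m\<in>I. f i m * cnj (f j m)) v
    = of_real (\<Sum>m\<in>I. (cmod (\<Sum>i<n. cnj (v i) * f i m))\<^sup>2)"
proof -
  have "qform n (\<lambda>i j. \<Sum>m\<in>I. f i m * cnj (f j m)) v
      = (\<Sum>i<n. \<Sum>j<n. \<Sum>m\<in>I. (cnj (v i) * f i m) * cnj (cnj (v j) * f j m))"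
    by (simp add: qform_def sum_distrib_left sum_distrib_right mult_ac)
  also have "\<dots> = (\<Sum>i<n. \<Sum>m\<in>I. \<Sum>j<n. (cnj (v i) * f i m) * cnj (cnj (v j) * f j m))"
    by (intro sum.cong refl sum.swap)
  also have "\<dots> = (\<Sum>m\<in>I. \<Sum>i<n. \<Sum>j<n. (cnj (v i) * f i m) * cnj (cnj (v j) * f j m))"
    by (rule sum.swap)
  also have "\<dots> = (\<Sum>m\<in>I. of_real ((cmod (\<Sum>i<n. cnj (v i) * f i m))\<^sup>2))"
    unfolding complex_norm_square cnj_sum sum_product ..
  finally show ?thesis
    by simp
qed

lemma psd_gram: "psd n (\<lambda>i j. \<Sum>m\<in>I. f i m * cnj (f j m))"
  by (intro psdI hermitianI) (simp_all add: qform_gram sum_nonneg mult.commute)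

text \<open>Schur's product theorem with one factor in Gram form: the Hadamard product is a sum over
  \<open>m\<close> of diagonal congruences of \<open>X\<close>.\<close>

lemma psd_schur_product:
  assumes "psd n X"
  shows "psd n (\<lambda>i j. (\<Sum>m\<in>I. f i m * cnj (f j m)) * X i j)"
proof (intro psdI hermitianI)
  fix i j assume "i < n" "j < n"
  then have "X j i = cnj (X i j)"
    using assms by (intro hermitianD psd_hermitian)
  then show "(\<Sum>m\<in>I. f j m * cnj (f i m)) * X j i = cnj ((\<Sum>m\<in>I. f i m * cnj (f j m)) * X i j)"
    by (simp add: mult.commute)
next
  fix v
  have "qform n (\<lambda>i j. (\<Sum>m\<in>I. f i m * cnj (f j m)) * X i j) v
      = (\<Sum>i<n. \<Sum>j<n. \<Sum>m\<in>I. cnj (cnj (f i m) * v i) * X i j * (cnj (f j m) * v j))"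
    by (simp add: qform_def sum_distrib_left sum_distrib_right mult_ac)
  also have "\<dots> = (\<Sum>i<n. \<Sum>m\<in>I. \<Sum>j<n. cnj (cnj (f i m) * v i) * X i j * (cnj (f j m) * v j))"
    by (intro sum.cong refl sum.swap)
  also have "\<dots> = (\<Sum>m\<in>I. qform n X (\<lambda>i. cnj (f i m) * v i))"
    unfolding qform_def by (rule sum.swap)
  finally show "0 \<le> Re (qform n (\<lambda>i j. (\<Sum>m\<in>I. f i m * cnj (f j m)) * X i j) v)"
    using assms by (simp add: sum_nonneg psd_qform)
qed

lemma qform_case_nat:
  "qform (Suc n) M (case_nat x w) = cnj x * M 0 0 * x + cnj x * (\<Sum>j<n. M 0 (Suc j) * w j)
    + (\<Sum>i<n. cnj (w i) * M (Suc i) 0) * x + qform n (\<lambda>i j. M (Suc i) (Suc j)) w"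
  unfolding qform_def
  by (simp add: sum.lessThan_Suc_shift sum.distrib sum_distrib_left sum_distrib_right mult.assoc
      del: sum.lessThan_Suc)

text \<open>Induction through the Schur complement of the first entry. The pivot may be 0; then the
  column below it vanishes, and the conventions \<open>inverse 0 = 0\<close> and
  \<open>x / 0 = 0\<close> let the same formulas cover that case.\<close>

lemma psd_cholesky:
  assumes "psd n M"
  shows "\<exists>C. (\<forall>i j. i < j \<longrightarrow> C i j = 0) \<and>
    (\<forall>i<n. \<forall>j<n. M i j = (\<Sum>m<n. C i m * cnj (C j m)))"
  using assms
proof (induction n arbitrary: M)
  case 0
  then show ?case
    by (intro exI[of _ "\<lambda>_ _. 0"]) simp
next
  case (Suc n)
  note herm = hermitianD[OF psd_hermitian[OF Suc.prems]]
  define d where "d = Re (M 0 0)"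
  have M00: "M 0 0 = of_real d"
    using herm[of 0 0] by (simp add: d_def complex_eq_iff)
  have d: "d \<ge> 0"
    using psd_qform[OF Suc.prems, of "case_nat 1 (\<lambda>_. 0)"]
    by (simp add: qform_case_nat M00) (simp add: qform_def)
  have swap: "M 0 (Suc i) = cnj (M (Suc i) 0)" if "i < n" for i
    using herm[of "Suc i" 0] that by simp
  \<comment> \<open>A zero pivot makes the first basis vector isotropic, hence a kernel
    vector.\<close>
  have col_zero: "M (Suc i) 0 = 0" if "d = 0" "i < n" for i
  proof -
    have "Re (qform (Suc n) M (case_nat 1 (\<lambda>_. 0))) = 0"
      by (simp add: qform_case_nat M00 that) (simp add: qform_def)
    from psd_isotropic[OF Suc.prems this, of "Suc i"] that show ?thesis
      by (simp add: sum.lessThan_Suc_shift del: sum.lessThan_Suc)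
  qed
  \<comment> \<open>The Schur complement of the pivot; for \<open>d = 0\<close> it is just the lower
    right block.\<close>
  define M' where "M' = (\<lambda>i j. M (Suc i) (Suc j) - M (Suc i) 0 * M 0 (Suc j) * of_real (inverse d))"
  have "psd n M'"
  proof (intro psdI hermitianI)
    fix i j assume "i < n" "j < n"
    then show "M' j i = cnj (M' i j)"
      using herm[of "Suc i" "Suc j"] by (simp add: M'_def swap)
  next
    fix w
    define b where "b = (\<Sum>j<n. M 0 (Suc j) * w j)"
    define D where "D = complex_of_real (inverse d)"
    \<comment> \<open>The first identity survives \<open>d = 0\<close>, since then
      \<open>D = 0\<close>, so one computation treats both pivots.\<close>
    have D: "D * of_real d * D = D" "cnj D = D"
      by (simp_all add: D_def field_simps)
    have b': "(\<Sum>i<n. cnj (w i) * M (Suc i) 0) = cnj b"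
      unfolding b_def cnj_sum by (intro sum.cong refl) (simp add: swap)
    \<comment> \<open>Minimising over the first coordinate: it is set to \<open>- b / M 0 0\<close>,
      which is 0 when \<open>M 0 0 = 0\<close>.\<close>
    have "qform (Suc n) M (case_nat (- (D * b)) w)
        = cnj b * (D * of_real d * D) * b - 2 * (cnj b * D * b) + qform n (\<lambda>i j. M (Suc i) (Suc j)) w"
      unfolding qform_case_nat b' M00 b_def[symmetric] by (simp add: D(2) algebra_simps)
    also have "\<dots> = qform n (\<lambda>i j. M (Suc i) (Suc j)) w - cnj b * D * b"
      unfolding D by simp
    also have "cnj b * D * b = qform n (\<lambda>i j. M (Suc i) 0 * M 0 (Suc j) * D) w"
      unfolding b'[symmetric] unfolding b_def qform_def
      by (simp add: sum_product sum_distrib_left sum_distrib_right mult_ac)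
    also have "qform n (\<lambda>i j. M (Suc i) (Suc j)) w - \<dots> = qform n M' w"
      unfolding M'_def qform_diff D_def ..
    finally have "qform (Suc n) M (case_nat (- (D * b)) w) = qform n M' w" .
    then show "0 \<le> Re (qform n M' w)"
      using psd_qform[OF Suc.prems] by metis
  qed
  from Suc.IH[OF this] obtain C where C: "\<And>i j. i < j \<Longrightarrow> C i j = 0"
    "\<And>i j. i < n \<Longrightarrow> j < n \<Longrightarrow> M' i j = (\<Sum>m<n. C i m * cnj (C j m))"
    by blast
  define s where "s = complex_of_real (sqrt d)"
  have s: "s * s = of_real d" "cnj s = s"
    using d by (simp_all add: s_def flip: of_real_mult)
  \<comment> \<open>The factor of the complement, bordered by the first column of \<open>M\<close>
    divided by the root of the pivot.\<close>
  define E where "E = (\<lambda>i j. case i of 0 \<Rightarrow> (case j of 0 \<Rightarrow> s | Suc _ \<Rightarrow> 0)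
    | Suc i' \<Rightarrow> (case j of 0 \<Rightarrow> M (Suc i') 0 / s | Suc j' \<Rightarrow> C i' j'))"
  have "E i j = 0" if "i < j" for i j
    using that by (auto simp: E_def C(1) split: nat.split)
  moreover have "M i j = (\<Sum>m<Suc n. E i m * cnj (E j m))" if ij: "i < Suc n" "j < Suc n" for i j
  proof -
    \<comment> \<open>For \<open>d = 0\<close> both sides vanish, by
      \<open>col_zero\<close>.\<close>
    have s_div: "M (Suc i) 0 / s * s = M (Suc i) 0" if "i < n" for i
      using col_zero[of i] that by (cases "d = 0") (auto simp: s_def)
    have s_div2: "M (Suc i) 0 / s * cnj (M (Suc j) 0 / s)
        = M (Suc i) 0 * cnj (M (Suc j) 0) * of_real (inverse d)" for i j
      by (simp add: s(2) s(1) divide_inverse flip: s(1))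
    show ?thesis
    proof (cases i)
      case 0
      show ?thesis
      proof (cases j)
        case 0
        with \<open>i = 0\<close> show ?thesis
          by (simp add: sum.lessThan_Suc_shift E_def M00 s del: sum.lessThan_Suc)
      next
        case (Suc j')
        then have "M 0 j = s * cnj (M (Suc j') 0 / s)"
          using s_div[of j'] ij swap[of j'] s(2)
          by (metis Suc_less_SucD complex_cnj_mult mult.commute)
        with \<open>i = 0\<close> Suc show ?thesis
          by (simp add: sum.lessThan_Suc_shift E_def del: sum.lessThan_Suc)
      qed
    next
      case (Suc i')
      show ?thesis
      proof (cases j)
        case 0
        with Suc ij s_div[of i'] show ?thesis
          by (simp add: sum.lessThan_Suc_shift E_def s(2) del: sum.lessThan_Suc)
      next
        case (Suc j')
        have "M i j = M (Suc i') 0 * cnj (M (Suc j') 0) * of_real (inverse d) + M' i' j'"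
          using \<open>i = Suc i'\<close> Suc ij by (simp add: M'_def swap)
        also have "\<dots> = M (Suc i') 0 / s * cnj (M (Suc j') 0 / s) + (\<Sum>m<n. C i' m * cnj (C j' m))"
          using \<open>i = Suc i'\<close> Suc ij by (simp only: s_div2 C(2) Suc_less_eq)
        also have "\<dots> = (\<Sum>m<Suc n. E i m * cnj (E j m))"
          using \<open>i = Suc i'\<close> Suc
          by (simp add: sum.lessThan_Suc_shift E_def del: sum.lessThan_Suc)
        finally show ?thesis .
      qed
    qed
  qed
  ultimately show ?case
    by blast
qed

subsection \<open>Congruence and Hadamard powers\<close>

lemma det_fmat_lower:
  assumes "\<And>i j. i < j \<Longrightarrow> A i j = 0"
  shows "det (fmat n A) = (\<Prod>i<n. A i i)"
proof -
  have "det (fmat n A) = prod_list (diag_mat (fmat n A))"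
    by (rule det_lower_triangular[OF _ fmat_carrier]) (simp add: assms)
  also have "\<dots> = (\<Prod>i<n. A i i)"
    by (simp add: diag_mat_def prod.list_conv_set_nth atLeast0LessThan)
  finally show ?thesis .
qed

lemma fmat_left_inverse:
  assumes "det (fmat n A) \<noteq> 0"
  obtains S where "fmat n S * fmat n A = 1\<^sub>m n"
proof -
  obtain B where B: "B \<in> carrier_mat n n" "B * fmat n A = 1\<^sub>m n"
    using det_non_zero_imp_unit[OF fmat_carrier assms, of "()"]
    by (auto simp: Units_def ring_mat_def)
  then show ?thesis
    using that[of "\<lambda>i j. B $$ (i, j)"] by (simp add: fmat_of_mat)
qed

lemma fmat_mult_eq_one:
  assumes "fmat n A * fmat n B = 1\<^sub>m n" "i < n" "j < n"
  shows "(\<Sum>m<n. A i m * B m j) = (if i = j then 1 else 0)"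
  using arg_cong[OF assms(1), of "\<lambda>X. X $$ (i, j)"] assms(2,3) by (simp add: fmat_mult)

lemma det_fmat_adjoint: "det (fmat n (\<lambda>i j. cnj (A j i))) = cnj (det (fmat n A))"
proof -
  interpret cnj: comm_ring_hom cnj
    by unfold_locales auto
  have "fmat n (\<lambda>i j. cnj (A j i)) = map_mat cnj (transpose_mat (fmat n A))"
    by (rule eq_matI) auto
  then show ?thesis
    by (simp only: cnj.hom_det det_transpose[OF fmat_carrier])
qed

definition congruence :: "nat \<Rightarrow> (nat \<Rightarrow> nat \<Rightarrow> complex) \<Rightarrow> (nat \<Rightarrow> nat \<Rightarrow> complex) \<Rightarrow> nat \<Rightarrow> nat \<Rightarrow> complex"
  where "congruence n S M i j = (\<Sum>p<n. \<Sum>q<n. S i p * M p q * cnj (S j q))"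

lemma congruence_diag: "congruence n S M i i = qform n M (\<lambda>p. cnj (S i p))"
  by (simp add: congruence_def qform_def)

lemma qform_congruence:
  "qform n (congruence n S M) v = qform n M (\<lambda>p. \<Sum>i<n. cnj (S i p) * v i)"
proof -
  define u where "u = (\<lambda>p. \<Sum>i<n. cnj (S i p) * v i)"
  have cnj_u: "cnj (u p) = (\<Sum>i<n. cnj (v i) * S i p)" for p
    by (simp add: u_def mult.commute)
  have "qform n (congruence n S M) v
      = (\<Sum>i<n. \<Sum>j<n. \<Sum>p<n. \<Sum>q<n. cnj (v i) * S i p * M p q * (cnj (S j q) * v j))"
    by (simp add: qform_def congruence_def sum_distrib_left sum_distrib_right mult_ac)
  also have "\<dots> = (\<Sum>i<n. \<Sum>p<n. \<Sum>j<n. \<Sum>q<n. cnj (v i) * S i p * M p q * (cnj (S j q) * v j))"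
    by (intro sum.cong refl sum.swap)
  also have "\<dots> = (\<Sum>i<n. \<Sum>p<n. \<Sum>q<n. \<Sum>j<n. cnj (v i) * S i p * M p q * (cnj (S j q) * v j))"
    by (intro sum.cong refl sum.swap)
  also have "\<dots> = (\<Sum>i<n. \<Sum>p<n. \<Sum>q<n. cnj (v i) * S i p * M p q * u q)"
    by (simp add: u_def sum_distrib_left)
  also have "\<dots> = (\<Sum>p<n. \<Sum>i<n. \<Sum>q<n. cnj (v i) * S i p * M p q * u q)"
    by (rule sum.swap)
  also have "\<dots> = (\<Sum>p<n. \<Sum>q<n. \<Sum>i<n. cnj (v i) * S i p * M p q * u q)"
    by (intro sum.cong refl sum.swap)
  also have "\<dots> = qform n M u"
    by (simp add: qform_def cnj_u sum_distrib_right)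
  finally show ?thesis
    by (simp only: u_def)
qed

lemma hermitian_congruence:
  assumes "hermitian n M" shows "hermitian n (congruence n S M)"
proof (rule hermitianI)
  fix i j
  have "congruence n S M j i = (\<Sum>q<n. \<Sum>p<n. S j p * M p q * cnj (S i q))"
    unfolding congruence_def by (rule sum.swap)
  also have "\<dots> = cnj (congruence n S M i j)"
    unfolding congruence_def cnj_sum
  proof (intro sum.cong refl)
    fix p q assume "p \<in> {..<n}" "q \<in> {..<n}"
    then have "M q p = cnj (M p q)"
      by (intro hermitianD[OF assms]) simp_all
    then show "S j q * M q p * cnj (S i p) = cnj (S i p * M p q * cnj (S j q))"
      by (simp add: mult_ac)
  qed
  finally show "congruence n S M j i = cnj (congruence n S M i j)" .
qed

lemma psd_congruence: "psd n M \<Longrightarrow> psd n (congruence n S M)"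
  by (simp add: psd_def qform_congruence hermitian_congruence)

lemma det_congruence:
  "det (fmat n (congruence n S M)) = of_real ((cmod (det (fmat n S)))\<^sup>2) * det (fmat n M)"
proof -
  have "fmat n (congruence n S M) = fmat n S * fmat n M * fmat n (\<lambda>i j. cnj (S j i))"
    unfolding fmat_mult congruence_def
    by (intro fmat_cong) (simp add: sum_distrib_right, rule sum.swap)
  also have "det \<dots> = det (fmat n S) * det (fmat n M) * cnj (det (fmat n S))"
    by (simp add: det_mult[of _ n] mult_carrier_mat[of _ n n] det_fmat_adjoint)
  finally show ?thesis
    unfolding complex_norm_square by (simp add: mult_ac)
qed

text \<open>Congruence with S, the inverse of W, turns W W* into the identity. Hence S M S*
  dominates the identity and has determinant at least 1; multiplying by |det W|^2 undoes the
  congruence.\<close>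

lemma det_ge_gram:
  assumes M: "hermitian n M"
    and diff: "psd n (\<lambda>i j. M i j - (\<Sum>m<n. W i m * cnj (W j m)))"
    and W: "det (fmat n W) \<noteq> 0"
  shows "(cmod (det (fmat n W)))\<^sup>2 \<le> Re (det (fmat n M))"
proof -
  obtain S where S: "fmat n S * fmat n W = 1\<^sub>m n"
    using fmat_left_inverse[OF W] by blast
  have detS: "cmod (det (fmat n S)) * cmod (det (fmat n W)) = 1"
    using arg_cong[OF S, of det] by (simp add: det_mult[of _ n] flip: norm_mult)
  have "1 \<le> Re (det (fmat n (congruence n S M)))"
  proof (rule hermitian_det_ge_one[OF hermitian_congruence[OF M]])
    fix v
    define u where "u = (\<lambda>p. \<Sum>i<n. cnj (S i p) * v i)"
    \<comment> \<open>Since u = S* v, this is the conjugate of W* u = (S W)* v = v.\<close>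
    have "(\<Sum>i<n. cnj (u i) * W i m) = cnj (v m)" if m: "m < n" for m
    proof -
      have "(\<Sum>i<n. cnj (u i) * W i m) = (\<Sum>i<n. \<Sum>p<n. cnj (v p) * (S p i * W i m))"
        by (simp add: u_def sum_distrib_right mult.commute[of _ "cnj (v _)"] mult.assoc)
      also have "\<dots> = (\<Sum>p<n. cnj (v p) * (\<Sum>i<n. S p i * W i m))"
        unfolding sum_distrib_left by (rule sum.swap)
      also have "\<dots> = (\<Sum>p<n. if p = m then cnj (v p) else 0)"
        by (intro sum.cong refl) (simp add: fmat_mult_eq_one[OF S] m)
      finally show ?thesis
        using m by simp
    qed
    then have "Re (qform n (\<lambda>i j. \<Sum>m<n. W i m * cnj (W j m)) u) = (\<Sum>m<n. (cmod (v m))\<^sup>2)"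
      by (simp add: qform_gram)
    then show "(\<Sum>m<n. (cmod (v m))\<^sup>2) \<le> Re (qform n (congruence n S M) v)"
      using psd_qform[OF diff, of u] by (simp add: qform_diff qform_congruence u_def)
  qed
  then have "1 \<le> (cmod (det (fmat n S)))\<^sup>2 * Re (det (fmat n M))"
    by (simp add: det_congruence)
  then have "(cmod (det (fmat n W)))\<^sup>2 * 1
      \<le> (cmod (det (fmat n W)))\<^sup>2 * ((cmod (det (fmat n S)))\<^sup>2 * Re (det (fmat n M)))"
    by (rule mult_left_mono) simp
  also have "\<dots> = (cmod (det (fmat n S)) * cmod (det (fmat n W)))\<^sup>2 * Re (det (fmat n M))"
    by (simp add: power_mult_distrib)
  finally show ?thesis
    by (simp add: detS)
qed

text \<open>Induction: multiply the previous difference entrywise by \<open>T\<close>, which keeps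
  it positive semidefinite, and add the mixed terms, which form a Gram matrix. Exponents start at 1,
  since at exponent 0 every entry of the difference would be 1 - n.\<close>

lemma psd_hadamard_power_diff:
  fixes C :: "nat \<Rightarrow> nat \<Rightarrow> complex" and n :: nat
  defines "T \<equiv> \<lambda>i j. \<Sum>m<n. C i m * cnj (C j m)"
  shows "psd n (\<lambda>i j. T i j ^ Suc r - (\<Sum>m<n. C i m ^ Suc r * cnj (C j m ^ Suc r)))"
proof (induction r)
  case 0
  show ?case
    by (simp add: T_def psd_def hermitian_def qform_def)
next
  case (Suc r)
  define W where "W = (\<lambda>i m. C i m ^ Suc r)"
  define off where "off = {x \<in> {..<n} \<times> {..<n}. fst x \<noteq> snd x}"
  define E where "E = (\<lambda>i x. C i (fst x) * W i (snd x))"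
  \<comment> \<open>A Hadamard product of Gram matrices is the Gram matrix of the products indexed
    by pairs. Diagonal pairs give the next power of \<open>C\<close>, the pairs in
    \<open>off\<close> the mixed terms.\<close>
  have split: "T i j * (\<Sum>m<n. W i m * cnj (W j m))
      = (\<Sum>x\<in>off. E i x * cnj (E j x)) + (\<Sum>m<n. C i m ^ Suc (Suc r) * cnj (C j m ^ Suc (Suc r)))"
    for i j
  proof -
    have "T i j * (\<Sum>m<n. W i m * cnj (W j m)) = (\<Sum>x\<in>{..<n} \<times> {..<n}. E i x * cnj (E j x))"
      by (simp add: T_def E_def sum_product sum.cartesian_product case_prod_unfold mult_ac)
    also have "{..<n} \<times> {..<n} = off \<union> (\<lambda>m. (m, m)) ` {..<n}"
      by (auto simp: off_def)
    also have "(\<Sum>x\<in>\<dots>. E i x * cnj (E j x))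
        = (\<Sum>x\<in>off. E i x * cnj (E j x)) + (\<Sum>x\<in>(\<lambda>m. (m, m)) ` {..<n}. E i x * cnj (E j x))"
      by (rule sum.union_disjoint) (auto simp: off_def)
    also have "(\<Sum>x\<in>(\<lambda>m. (m, m)) ` {..<n}. E i x * cnj (E j x))
        = (\<Sum>m<n. C i m ^ Suc (Suc r) * cnj (C j m ^ Suc (Suc r)))"
      by (subst sum.reindex) (auto simp: inj_on_def E_def W_def mult_ac)
    finally show ?thesis .
  qed
  have "psd n (\<lambda>i j. (\<Sum>m<n. C i m * cnj (C j m)) *
      (T i j ^ Suc r - (\<Sum>m<n. W i m * cnj (W j m))) + (\<Sum>x\<in>off. E i x * cnj (E j x)))"
    unfolding W_def by (intro psd_add psd_schur_product Suc.IH psd_gram)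
  then show ?case
  proof (rule psd_cong)
    fix i j
    show "(\<Sum>m<n. C i m * cnj (C j m)) *
      (T i j ^ Suc r - (\<Sum>m<n. W i m * cnj (W j m))) + (\<Sum>x\<in>off. E i x * cnj (E j x))
      = T i j ^ Suc (Suc r) - (\<Sum>m<n. C i m ^ Suc (Suc r) * cnj (C j m ^ Suc (Suc r)))"
      using split[of i j] unfolding T_def by (simp add: right_diff_distrib)
  qed
qed

subsection \<open>Partial traces\<close>

lemma block_index_less:
  fixes i a n k :: nat
  assumes "i < n" "a < k"
  shows "i * k + a < n * k"
proof -
  have "i * k + a < Suc i * k"
    using assms(2) by simp
  also have "\<dots> \<le> n * k"
    using assms(1) by (intro mult_right_mono) simp_all
  finally show ?thesis .
qed

lemma sum_mod_eq:
  fixes g :: "nat \<Rightarrow> 'a :: comm_monoid_add"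
  assumes "a < k"
  shows "(\<Sum>p<n * k. if p mod k = a then g p else 0) = (\<Sum>i<n. g (i * k + a))"
proof -
  have "(\<Sum>p<n * k. if p mod k = a then g p else 0) = sum g {p \<in> {..<n * k}. p mod k = a}"
    by (rule sum.inter_filter[symmetric]) simp
  also have "\<dots> = (\<Sum>i<n. g (i * k + a))"
    using assms
    by (intro sum.reindex_bij_witness[of _ "\<lambda>i. i * k + a" "\<lambda>p. p div k"])
      (auto simp: less_mult_imp_div_less intro: block_index_less)
  finally show ?thesis .
qed

lemma sum_blocks:
  fixes g :: "nat \<Rightarrow> 'a :: comm_monoid_add"
  shows "(\<Sum>p<n * k. g p) = (\<Sum>i<n. \<Sum>a<k. g (i * k + a))"
  using sum.shift_bounds_nat_ivl[of g 0 "i * k" k for i]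
  by (simp add: sum.nat_group[symmetric] atLeast0LessThan add.commute)

definition partial_trace :: "nat \<Rightarrow> (nat \<Rightarrow> nat \<Rightarrow> complex) \<Rightarrow> nat \<Rightarrow> nat \<Rightarrow> complex"
  where "partial_trace k H i j = (\<Sum>a<k. H (i * k + a) (j * k + a))"

text \<open>The partial trace is the sum over \<open>a\<close> of the principal submatrices of
  \<open>H\<close> on the indices congruent to \<open>a\<close> mod \<open>k\<close>; the vectors on
  the right are v \<otimes> e_a.\<close>

lemma qform_partial_trace:
  "qform n (partial_trace k H) v
    = (\<Sum>a<k. qform (n * k) H (\<lambda>p. if p mod k = a then v (p div k) else 0))"
proof -
  have "qform (n * k) H (\<lambda>p. if p mod k = a then v (p div k) else 0)
      = (\<Sum>i<n. \<Sum>j<n. cnj (v i) * H (i * k + a) (j * k + a) * v j)" if a: "a < k" for a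
  proof -
    have "qform (n * k) H (\<lambda>p. if p mod k = a then v (p div k) else 0)
        = (\<Sum>p<n * k. if p mod k = a then (\<Sum>q<n * k. if q mod k = a
            then cnj (v (p div k)) * H p q * v (q div k) else 0) else 0)"
      unfolding qform_def by (intro sum.cong refl) (auto intro!: sum.cong)
    then show ?thesis
      using a by (simp add: sum_mod_eq)
  qed
  then have "(\<Sum>a<k. qform (n * k) H (\<lambda>p. if p mod k = a then v (p div k) else 0))
      = (\<Sum>a<k. \<Sum>i<n. \<Sum>j<n. cnj (v i) * H (i * k + a) (j * k + a) * v j)"
    by simp
  also have "\<dots> = (\<Sum>i<n. \<Sum>a<k. \<Sum>j<n. cnj (v i) * H (i * k + a) (j * k + a) * v j)"
    by (rule sum.swap)
  also have "\<dots> = (\<Sum>i<n. \<Sum>j<n. \<Sum>a<k. cnj (v i) * H (i * k + a) (j * k + a) * v j)"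
    by (intro sum.cong refl sum.swap)
  finally show ?thesis
    by (simp add: qform_def partial_trace_def sum_distrib_left sum_distrib_right)
qed

lemma psd_partial_trace:
  assumes "psd (n * k) H"
  shows "psd n (partial_trace k H)"
proof (intro psdI hermitianI)
  fix i j assume ij: "i < n" "j < n"
  have "H (j * k + a) (i * k + a) = cnj (H (i * k + a) (j * k + a))" if "a < k" for a
    using ij that by (intro hermitianD[OF psd_hermitian[OF assms]] block_index_less)
  then show "partial_trace k H j i = cnj (partial_trace k H i j)"
    by (simp add: partial_trace_def)
next
  fix v
  show "0 \<le> Re (qform n (partial_trace k H) v)"
    by (simp add: qform_partial_trace sum_nonneg psd_qform[OF assms])
qed

section \<open>Kronecker products A \<otimes> I with the k x k identity, and the upper bound for det
  H\<close>

definition kron_id :: "nat \<Rightarrow> (nat \<Rightarrow> nat \<Rightarrow> complex) \<Rightarrow> nat \<Rightarrow> nat \<Rightarrow> complex"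
  where "kron_id k A p q = (if p mod k = q mod k then A (p div k) (q div k) else 0)"

lemma kron_id_mult:
  assumes "k > 0"
  shows "fmat (n * k) (kron_id k A) * fmat (n * k) (kron_id k B)
    = fmat (n * k) (kron_id k (\<lambda>i j. \<Sum>m<n. A i m * B m j))"
  unfolding fmat_mult
proof (rule fmat_cong)
  fix p q
  have "(\<Sum>m<n * k. kron_id k A p m * kron_id k B m q)
      = (\<Sum>m<n * k. if m mod k = p mod k then A (p div k) (m div k) * kron_id k B m q else 0)"
    by (intro sum.cong refl) (auto simp: kron_id_def)
  also have "\<dots> = kron_id k (\<lambda>i j. \<Sum>m<n. A i m * B m j) p q"
    using assms by (simp add: sum_mod_eq) (simp add: kron_id_def)
  finally show "(\<Sum>m<n * k. kron_id k A p m * kron_id k B m q)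
      = kron_id k (\<lambda>i j. \<Sum>m<n. A i m * B m j) p q" .
qed

text \<open>Triangularity is inherited because \<open>div\<close> is monotone: a nonzero entry with
  p < q would need equal residues, hence a strictly smaller block row. Each diagonal entry of
  \<open>A\<close> then occurs \<open>k\<close> times.\<close>

lemma det_kron_id_lower:
  assumes "\<And>i j. i < j \<Longrightarrow> A i j = 0" "k > 0"
  shows "det (fmat (n * k) (kron_id k A)) = (\<Prod>i<n. A i i) ^ k"
proof -
  have "det (fmat (n * k) (kron_id k A)) = (\<Prod>p<n * k. kron_id k A p p)"
  proof (rule det_fmat_lower)
    fix p q :: nat assume "p < q"
    then have "p div k \<noteq> q div k \<or> p mod k \<noteq> q mod k"
      by (metis div_mult_mod_eq less_irrefl)
    moreover have "p div k \<le> q div k"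
      using \<open>p < q\<close> by (simp add: div_le_mono)
    ultimately show "kron_id k A p q = 0"
      using assms(1) by (auto simp: kron_id_def)
  qed
  also have "\<dots> = (\<Prod>i<n. \<Prod>p = i * k..<i * k + k. A (p div k) (p div k))"
    by (simp add: kron_id_def prod.nat_group)
  also have "\<dots> = (\<Prod>i<n. \<Prod>p = i * k..<i * k + k. A i i)"
  proof (intro prod.cong refl)
    fix i p assume "p \<in> {i * k..<i * k + k}"
    then have "p div k = i"
      by (intro div_nat_eqI) (auto simp: mult.commute)
    then show "A (p div k) (p div k) = A i i"
      by simp
  qed
  also have "\<dots> = (\<Prod>i<n. A i i) ^ k"
    by (simp add: prod_power_distrib)
  finally show ?thesis .
qed

lemma kron_id_one:
  assumes "fmat n A = 1\<^sub>m n"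
  shows "fmat (n * k) (kron_id k A) = 1\<^sub>m (n * k)"
proof (rule eq_matI)
  fix p q assume "p < dim_row (1\<^sub>m (n * k) :: complex mat)" "q < dim_col (1\<^sub>m (n * k) :: complex mat)"
  then have pq: "p < n * k" "q < n * k" by simp_all
  then have "A (p div k) (q div k) = (if p div k = q div k then 1 else 0)"
    using arg_cong[OF assms, of "\<lambda>X. X $$ (p div k, q div k)"] by (simp add: less_mult_imp_div_less)
  moreover have "p = q \<longleftrightarrow> p div k = q div k \<and> p mod k = q mod k"
    by (metis div_mult_mod_eq)
  ultimately show "fmat (n * k) (kron_id k A) $$ (p, q) = 1\<^sub>m (n * k) $$ (p, q)"
    using pq by (auto simp: kron_id_def)
qed simp_all

text \<open>A kernel vector v of C* is isotropic for the partial trace. The form there is a sum of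
  nonnegative values of the form of \<open>H\<close> at v \<otimes> e_a, so each of these vectors is
  isotropic for \<open>H\<close>.\<close>

lemma det_eq_0_of_partial_trace:
  assumes psd: "psd (n * k) H" and k: "k > 0"
    and C: "\<And>i j. i < n \<Longrightarrow> j < n \<Longrightarrow> partial_trace k H i j = (\<Sum>m<n. C i m * cnj (C j m))"
    and det: "det (fmat n C) = 0"
  shows "det (fmat (n * k) H) = 0"
proof -
  have "det (fmat n (\<lambda>i j. cnj (C j i))) = 0"
    by (simp add: det_fmat_adjoint det)
  then obtain v where v: "v \<in> carrier_vec n" "v \<noteq> 0\<^sub>v n"
    "fmat n (\<lambda>i j. cnj (C j i)) *\<^sub>v v = 0\<^sub>v n"
    using det_0_iff_vec_prod_zero[OF fmat_carrier] by blast
  have "(\<Sum>i<n. cnj (v $ i) * C i m) = 0" if "m < n" for m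
  proof -
    have "(\<Sum>i<n. cnj (C i m) * v $ i) = 0"
      using arg_cong[OF v(3), of "\<lambda>w. w $ m"] that v(1)
      by (simp add: scalar_prod_def atLeast0LessThan)
    from arg_cong[OF this, of cnj] show ?thesis
      by (simp add: mult.commute)
  qed
  then have "qform n (\<lambda>i j. \<Sum>m<n. C i m * cnj (C j m)) (\<lambda>i. v $ i) = 0"
    by (simp add: qform_gram)
  also have "qform n (\<lambda>i j. \<Sum>m<n. C i m * cnj (C j m)) (\<lambda>i. v $ i)
      = qform n (partial_trace k H) (\<lambda>i. v $ i)"
    by (intro qform_cong) (simp_all add: C)
  finally have "(\<Sum>a<k. Re (qform (n * k) H (\<lambda>p. if p mod k = a then v $ (p div k) else 0))) = 0"
    by (simp add: qform_partial_trace flip: Re_sum)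
  \<comment> \<open>One summand suffices; residue 0 exists because \<open>k > 0\<close>.\<close>
  then have iso: "Re (qform (n * k) H (\<lambda>p. if p mod k = 0 then v $ (p div k) else 0)) = 0"
    using k by (subst (asm) sum_nonneg_eq_0_iff) (auto intro: psd_qform[OF psd])
  define x where "x = vec (n * k) (\<lambda>p. if p mod k = 0 then v $ (p div k) else 0)"
  have "fmat (n * k) H *\<^sub>v x = 0\<^sub>v (n * k)"
    by (rule eq_vecI)
      (use psd_isotropic[OF psd iso] in \<open>simp_all add: x_def scalar_prod_def atLeast0LessThan\<close>)
  moreover have "x \<noteq> 0\<^sub>v (n * k)"
  proof -
    obtain i where i: "i < n" "v $ i \<noteq> 0"
      using v(1,2) by (metis eq_vecI carrier_vecD index_zero_vec)
    then have "x $ (i * k) = v $ i" "i * k < n * k"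
      using k by (simp_all add: x_def)
    then show ?thesis
      using i by auto
  qed
  moreover have "x \<in> carrier_vec (n * k)"
    by (simp add: x_def)
  ultimately show ?thesis
    using det_0_iff_vec_prod_zero[OF fmat_carrier] by blast
qed

lemma det_le_partial_trace:
  assumes psd: "psd (n * k) H" and k: "k > 0"
    and low: "\<And>i j. i < j \<Longrightarrow> C i j = 0"
    and C: "\<And>i j. i < n \<Longrightarrow> j < n \<Longrightarrow> partial_trace k H i j = (\<Sum>m<n. C i m * cnj (C j m))"
  shows "Re (det (fmat (n * k) H)) \<le> ((cmod (det (fmat n C)))\<^sup>2 / real k ^ n) ^ k"
proof (cases "det (fmat n C) = 0")
  case True
  then show ?thesis
    using det_eq_0_of_partial_trace[OF psd k C] by simp
next
  case False
  then obtain S where S: "fmat n S * fmat n C = 1\<^sub>m n"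
    using fmat_left_inverse by blast
  let ?K = "kron_id k S" and ?N = "n * k"
  \<comment> \<open>Nothing is known about the shape of \<open>S\<close>, so det (S \<otimes> I) is
    obtained as the inverse of det (C \<otimes> I), where \<open>C\<close> is lower
    triangular.\<close>
  have "fmat ?N ?K * fmat ?N (kron_id k C) = 1\<^sub>m ?N"
    unfolding kron_id_mult[OF k] using S by (intro kron_id_one) (simp add: fmat_mult)
  then have "det (fmat ?N ?K) * det (fmat ?N (kron_id k C)) = 1"
    by (simp flip: det_mult[OF fmat_carrier fmat_carrier])
  then have "det (fmat ?N ?K) * det (fmat n C) ^ k = 1"
    by (simp only: det_kron_id_lower[OF low k] det_fmat_lower[OF low])
  then have detK: "cmod (det (fmat ?N ?K)) * cmod (det (fmat n C)) ^ k = 1"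
    by (simp flip: norm_mult norm_power)
  \<comment> \<open>Row i * k + a of S \<otimes> I is the Kronecker product of row i of S and e_a,
    so summing over a produces the form of the partial trace.\<close>
  have "(\<Sum>p<?N. congruence ?N ?K H p p)
      = (\<Sum>i<n. \<Sum>a<k. qform ?N H (\<lambda>q. if q mod k = a then cnj (S i (q div k)) else 0))"
    unfolding sum_blocks congruence_diag
    by (intro sum.cong refl qform_cong) (auto simp: kron_id_def)
  also have "\<dots> = (\<Sum>i<n. qform n (partial_trace k H) (\<lambda>j. cnj (S i j)))"
    by (simp only: qform_partial_trace)
  also have "\<dots> = (\<Sum>i<n. qform n (\<lambda>i j. \<Sum>m<n. C i m * cnj (C j m)) (\<lambda>j. cnj (S i j)))"
    by (intro sum.cong refl qform_cong) (simp_all add: C)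
  \<comment> \<open>The form of C C* at the conjugated row i of S is the squared norm of row i of S
    C = I.\<close>
  also have "\<dots> = (\<Sum>i<n. \<Sum>m<n. if i = m then 1 else 0)"
  proof (rule sum.cong[OF refl])
    fix i assume i: "i \<in> {..<n}"
    have "(\<Sum>j<n. cnj (cnj (S i j)) * C j m) = (if i = m then 1 else 0)" if "m < n" for m
      unfolding complex_cnj_cnj using fmat_mult_eq_one[OF S] i that by blast
    then show "qform n (\<lambda>i j. \<Sum>m<n. C i m * cnj (C j m)) (\<lambda>j. cnj (S i j))
        = (\<Sum>m<n. if i = m then 1 else 0)"
      unfolding qform_gram of_real_sum by (intro sum.cong refl) auto
  qed
  also have "\<dots> = of_nat n"
    by simp
  finally have "Re (\<Sum>p<?N. congruence ?N ?K H p p) \<le> real ?N * (1 / real k)"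
    using k by simp
  then have "Re (det (fmat ?N (congruence ?N ?K H))) \<le> (1 / real k) ^ ?N"
    using k by (intro psd_det_le_trace psd_congruence psd) auto
  then have "(cmod (det (fmat ?N ?K)))\<^sup>2 * Re (det (fmat ?N H)) \<le> (1 / real k) ^ ?N"
    by (simp add: det_congruence)
  then have "(cmod (det (fmat n C)) ^ k)\<^sup>2 * ((cmod (det (fmat ?N ?K)))\<^sup>2 * Re (det (fmat ?N H)))
      \<le> (cmod (det (fmat n C)) ^ k)\<^sup>2 * (1 / real k) ^ ?N"
    by (rule mult_left_mono) simp
  also have "(cmod (det (fmat n C)) ^ k)\<^sup>2 * ((cmod (det (fmat ?N ?K)))\<^sup>2 * Re (det (fmat ?N H)))
      = (cmod (det (fmat ?N ?K)) * cmod (det (fmat n C)) ^ k)\<^sup>2 * Re (det (fmat ?N H))"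
    by (simp add: power_mult_distrib)
  also have "(cmod (det (fmat n C)) ^ k)\<^sup>2 * (1 / real k) ^ ?N
      = ((cmod (det (fmat n C)))\<^sup>2 / real k ^ n) ^ k"
    by (simp add: power_divide mult.commute flip: power_mult)
  finally show ?thesis
    by (simp add: detK)
qed

text \<open>The determinants are complex numbers; their membership in the reals makes the inequality
  between real parts one between the determinants themselves.\<close>

theorem theorem3p5:
  fixes n k r :: nat and H :: "complex mat"
  assumes "n \<ge> 1" and "k \<ge> 1"
    and "H \<in> carrier_mat (n * k) (n * k)"
    and "positive_semidefinite H"
    and "r \<ge> 1"
  shows "det (trace_power_mat n k r H) \<in> \<real> \<and> det H \<in> \<real> \<and>
    (Re (det (trace_power_mat n k r H)) / real k ^ (r * n)) ^ k \<ge> Re (det H) ^ r"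
proof -
  define h where "h = (\<lambda>i j. H $$ (i, j))"
  define T where "T = partial_trace k h"
  have psd_h: "psd (n * k) h"
    unfolding h_def by (rule positive_semidefinite_imp_psd[OF assms(3,4)])
  have H: "fmat (n * k) h = H"
    unfolding h_def by (rule fmat_of_mat[OF assms(3)])
  obtain C where low: "\<And>i j. i < j \<Longrightarrow> C i j = 0"
    and C: "\<And>i j. i < n \<Longrightarrow> j < n \<Longrightarrow> T i j = (\<Sum>m<n. C i m * cnj (C j m))"
    using psd_cholesky[OF psd_partial_trace[OF psd_h]] unfolding T_def by blast
  define x where "x = (cmod (det (fmat n C)))\<^sup>2"
  define W where "W = (\<lambda>i m. C i m ^ r)"
  define P where "P = (\<lambda>i j. T i j ^ r)"
  have diff: "psd n (\<lambda>i j. P i j - (\<Sum>m<n. W i m * cnj (W j m)))"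
    using psd_hadamard_power_diff[of n C "r - 1"] assms(5)
    by (elim psd_cong) (simp add: C P_def W_def)
  have psd_P: "psd n P"
    using psd_add[OF diff psd_gram] by (rule psd_cong) simp
  have TP: "trace_power_mat n k r H = fmat n P"
    by (simp add: trace_power_mat_def fmat_def P_def T_def partial_trace_def mat_tr_def
        mat_block_def h_def)
  \<comment> \<open>As \<open>r\<close> is positive, entrywise powers keep the zeros above the
    diagonal, so both determinants are diagonal products.\<close>
  have "det (fmat n W) = det (fmat n C) ^ r"
    using assms(5) by (simp add: det_fmat_lower low W_def prod_power_distrib)
  then have x_W: "(cmod (det (fmat n W)))\<^sup>2 = x ^ r"
    by (simp add: x_def norm_power power_mult[symmetric] mult.commute)
  \<comment> \<open>For singular \<open>W\<close> the left side is 0 and the bound is just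
    nonnegativity of the determinant of \<open>P\<close>; \<open>det_ge_gram\<close> covers the
    invertible case.\<close>
  have x_P: "x ^ r \<le> Re (det (fmat n P))"
  proof (cases "det (fmat n W) = 0")
    case True
    have "x ^ r = 0"
      unfolding x_W[symmetric] by (simp add: True)
    then show ?thesis
      using psd_det(2)[OF psd_P] by linarith
  next
    case False
    then show ?thesis
      using det_ge_gram[OF psd_hermitian[OF psd_P] diff] x_W by simp
  qed
  have "Re (det H) \<le> (x / real k ^ n) ^ k"
    using det_le_partial_trace[OF psd_h _ low C[unfolded T_def]] assms(2) H by (simp add: x_def)
  then have "Re (det H) ^ r \<le> ((x / real k ^ n) ^ k) ^ r"
    using psd_det(2)[OF psd_h] H by (intro power_mono) simp_all
  also have "\<dots> = (x ^ r / real k ^ (r * n)) ^ k"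
    by (simp add: power_divide power_mult[symmetric] mult_ac)
  also have "\<dots> \<le> (Re (det (fmat n P)) / real k ^ (r * n)) ^ k"
    using x_P by (intro power_mono divide_right_mono) (auto simp: x_def)
  finally show ?thesis
    using psd_det(1)[OF psd_P] psd_det(1)[OF psd_h] by (simp add: TP H)
qed

end
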